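(* Let $a$ be a parameter and let $D_n(a)=\sum_{\sigma\in\mathcal{D}_n}a^{\mathrm{rlm}(\sigma)}$ for $n\ge0$ (with $D_0(a)=1$), where $\mathcal{D}_n$ is the set of derangements of $[n]$. Define polynomials $P_{-1}(x)=0$, $P_0(x)=1$ and, for $n\ge 0$, $$P_n(x)=L_n^{(a-1)}(x+1)+(a-1)L_{n-1}^{(a-1)}(x+1;1).$$ Then $\{D_n(a)\}_{n\ge0}$ is the moment sequence of the orthogonal polynomials $\{P_n(x)\}_{n\ge0}$: the linear functional $\mathcal{L}$ on polynomials in $x$ defined by $\mathcal{L}(x^n)=D_n(a)$ satisfies $\mathcal{L}(P_mP_n)=0$ for $m\ne n$ and $\mathcal{L}(P_n^2)\neq 0$ (for $a$ such that $n(n+a-1)\neq 0$ for all $n\ge1$).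
   Context: A derangement is a permutation without fixed points; $\mathrm{rlm}(\sigma)$ is the number of right-to-left minima of $\sigma$, i.e. of values $\sigma(i)$ with $\sigma(i)<\sigma(k)$ for all $k>i$. The monic Laguerre polynomials $L_n^{(\alpha)}(x)$ are defined by $L_{-1}^{(\alpha)}(x)=0$, $L_0^{(\alpha)}(x)=1$ and $L_{n+1}^{(\alpha)}(x)=(x-(\alpha+2n+1))L_n^{(\alpha)}(x)-n(n+\alpha)L_{n-1}^{(\alpha)}(x)$ for $n\ge0$ (equivalently $\sum_{n\ge0}L_n^{(\alpha)}(x)t^n/n!=(1+t)^{-1-\alpha}\exp(xt/(1+t))$). The associated Laguerre polynomials $L_n^{(\alpha)}(x;c)$ are defined by $L_{-1}^{(\alpha)}(x;c)=0$, $L_0^{(\alpha)}(x;c)=1$ and $L_{n+1}^{(\alpha)}(x;c)=(x-(\alpha+2n+2c+1))L_n^{(\alpha)}(x;c)-(n+c)(n+c+\alpha)L_{n-1}^{(\alpha)}(x;c)$ for $n\ge0$. *)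

theory Defs
  imports Complex_Main "HOL-Computational_Algebra.Polynomial" "HOL-Combinatorics.Permutations"
begin

text \<open>Permutations of \<open>[n]\<close> are functions on \<^typ>\<open>nat\<close> permuting \<open>{1..n}\<close> and fixing everything else.\<close>

definition derangements :: "nat \<Rightarrow> (nat \<Rightarrow> nat) set" where
  "derangements n = {\<sigma>. \<sigma> permutes {1..n} \<and> (\<forall>i\<in>{1..n}. \<sigma> i \<noteq> i)}"

definition rlm :: "nat \<Rightarrow> (nat \<Rightarrow> nat) \<Rightarrow> nat" where
  "rlm n \<sigma> = card {\<sigma> i |i. i \<in> {1..n} \<and> (\<forall>k\<in>{i<..n}. \<sigma> i < \<sigma> k)}"

definition derangement_poly :: "'a::comm_ring_1 \<Rightarrow> nat \<Rightarrow> 'a" where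
  "derangement_poly a n = (\<Sum>\<sigma>\<in>derangements n. a ^ rlm n \<sigma>)"

text \<open>
  Both recurrences start from the value \<open>0\<close> at index \<open>-1\<close>, so at index \<open>1\<close> only
  the first term survives.
\<close>

fun laguerre :: "'a::comm_ring_1 \<Rightarrow> nat \<Rightarrow> 'a poly" where
  "laguerre \<alpha> 0 = 1"
| "laguerre \<alpha> (Suc 0) = [:- (\<alpha> + 1), 1:]"
| "laguerre \<alpha> (Suc (Suc n)) =
     [:- (\<alpha> + 2 * of_nat (Suc n) + 1), 1:] * laguerre \<alpha> (Suc n)
     - smult (of_nat (Suc n) * (of_nat (Suc n) + \<alpha>)) (laguerre \<alpha> n)"

fun assoc_laguerre :: "'a::comm_ring_1 \<Rightarrow> 'a \<Rightarrow> nat \<Rightarrow> 'a poly" where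
  "assoc_laguerre \<alpha> c 0 = 1"
| "assoc_laguerre \<alpha> c (Suc 0) = [:- (\<alpha> + 2 * c + 1), 1:]"
| "assoc_laguerre \<alpha> c (Suc (Suc n)) =
     [:- (\<alpha> + 2 * of_nat (Suc n) + 2 * c + 1), 1:] * assoc_laguerre \<alpha> c (Suc n)
     - smult ((of_nat (Suc n) + c) * (of_nat (Suc n) + c + \<alpha>)) (assoc_laguerre \<alpha> c n)"

text \<open>
  Composition with \<open>[:1, 1:]\<close> is the substitution of \<open>x + 1\<close> for \<open>x\<close>; the case
  distinction is again the value \<open>0\<close> at index \<open>-1\<close>.
\<close>

definition derangement_ops :: "'a::comm_ring_1 \<Rightarrow> nat \<Rightarrow> 'a poly" where
  "derangement_ops a n =
     pcompose (laguerre (a - 1) n) [:1, 1:]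
     + smult (a - 1)
         (case n of 0 \<Rightarrow> 0 | Suc m \<Rightarrow> pcompose (assoc_laguerre (a - 1) 1 m) [:1, 1:])"

text \<open>The linear functional on polynomials sending \<open>x\<^sup>n\<close> to \<open>\<mu> n\<close>.\<close>

definition moment_functional :: "(nat \<Rightarrow> 'a::comm_ring_1) \<Rightarrow> 'a poly \<Rightarrow> 'a" where
  "moment_functional \<mu> p = (\<Sum>i\<le>degree p. coeff p i * \<mu> i)"

lemma moment_functional_altdef:
  assumes "degree p \<le> N"
  shows "moment_functional \<mu> p = (\<Sum>i\<le>N. coeff p i * \<mu> i)"
  unfolding moment_functional_def using assms
  by (intro sum.mono_neutral_left) (auto simp: coeff_eq_0)

lemma moment_functional_monom: "moment_functional \<mu> (monom 1 n) = \<mu> n"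
proof -
  have "moment_functional \<mu> (monom 1 n) = (\<Sum>i\<le>n. coeff (monom 1 n) i * \<mu> i)"
    by (intro moment_functional_altdef) (simp add: degree_monom_le)
  also have "\<dots> = (\<Sum>i\<le>n. if i = n then \<mu> i else 0)"
    by (intro sum.cong) auto
  finally show ?thesis by simp
qed

lemma moment_functional_add:
  "moment_functional \<mu> (p + q) = moment_functional \<mu> p + moment_functional \<mu> q"
proof -
  let ?N = "max (degree p) (degree q)"
  have "degree (p + q) \<le> ?N" by (rule degree_add_le_max)
  then show ?thesis
    by (simp add: moment_functional_altdef[of _ ?N] sum.distrib algebra_simps)
qed

lemma moment_functional_smult:
  "moment_functional \<mu> (smult c p) = c * moment_functional \<mu> p"
proof -
  have "degree (smult c p) \<le> degree p" by (rule degree_smult_le)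
  then show ?thesis
    by (simp add: moment_functional_altdef[of _ "degree p"] sum_distrib_left mult.assoc)
qed

end

theory Submission
  imports Defs "HOL-Library.Infinite_Set" "HOL-Combinatorics.Multiset_Permutations"
begin

text \<open>
  Deleting the fixed points of a permutation does not change which of the other positions are
  right-to-left minima. Hence the binomial transform of \<open>D\<^sub>n(a)\<close>, which is the moment sequence
  in the variable \<open>x + 1\<close>, is \<open>M\<^sub>n = \<Sum>\<^sub>\<sigma> a\<^sup>r\<close> where \<open>r\<close> counts the right-to-left minima of
  \<open>\<sigma> \<in> S\<^sub>n\<close> that are not fixed points. Cutting permutations at a right-to-left minimum that is a
  fixed point relates \<open>M\<^sub>n\<close> to the full sum \<open>F\<^sub>n = a(a + 1)\<cdots>(a + n - 1)\<close> by
  \<open>F\<^sub>n = M\<^sub>n + (a - 1) \<Sum>\<^sub>j F\<^sub>j M\<^sub>n\<^sub>-\<^sub>1\<^sub>-\<^sub>j\<close>. The same relation links the moments of two Jacobi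
  matrices that differ only in the corner entry, here \<open>a\<close> for the Laguerre polynomials (whose
  moments are the \<open>F\<^sub>n\<close>) and \<open>1\<close> for the polynomials \<open>P\<^sub>n\<close>. So \<open>M\<^sub>n\<close> is the moment sequence of
  \<open>P\<^sub>n\<close> in the variable \<open>x + 1\<close>.
\<close>

subsection \<open>Moments of tridiagonal matrices\<close>

text \<open>
  \<open>motzkin b l n k\<close> is the entry \<open>(0, k)\<close> of the \<open>n\<close>th power of the tridiagonal matrix with
  diagonal \<open>b\<close>, superdiagonal \<open>1\<close> and subdiagonal \<open>l 1, l 2, \<dots>\<close>.
\<close>

primrec motzkin :: "(nat \<Rightarrow> 'a::comm_ring_1) \<Rightarrow> (nat \<Rightarrow> 'a) \<Rightarrow> nat \<Rightarrow> nat \<Rightarrow> 'a" where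
  "motzkin b l 0 k = (if k = 0 then 1 else 0)"
| "motzkin b l (Suc n) k = (case k of 0 \<Rightarrow> 0 | Suc j \<Rightarrow> motzkin b l n j)
     + b k * motzkin b l n k + l (Suc k) * motzkin b l n (Suc k)"

lemma motzkin_eq_0: "n < k \<Longrightarrow> motzkin b l n k = 0"
  by (induction n arbitrary: k) (auto split: nat.splits)

lemma motzkin_diag: "motzkin b l n n = 1"
  by (induction n) (auto simp: motzkin_eq_0)

text \<open>The resolvent identity for tridiagonal matrices that differ only in the corner entry.\<close>

lemma motzkin_change_corner:
  assumes "\<And>k. k > 0 \<Longrightarrow> b k = b' k"
  shows "motzkin b l n k =
    motzkin b' l n k + (b 0 - b' 0) * (\<Sum>j<n. motzkin b l j 0 * motzkin b' l (n - 1 - j) k)"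
proof (induction n arbitrary: k)
  case 0
  show ?case by simp
next
  case (Suc n)
  define S where "S k = (\<Sum>j<n. motzkin b l j 0 * motzkin b' l (n - 1 - j) k)" for k
  have IH: "motzkin b l n k = motzkin b' l n k + (b 0 - b' 0) * S k" for k
    unfolding S_def by (rule Suc.IH)
  have eq: "(\<Sum>j<n. motzkin b l j 0 * motzkin b' l (n - j) k) =
      (\<Sum>j<n. motzkin b l j 0 * motzkin b' l (Suc (n - 1 - j)) k)" for k
    by (intro sum.cong) (auto simp: Suc_diff_Suc)
  have S_Suc: "(\<Sum>j<n. motzkin b l j 0 * motzkin b' l (n - j) k) =
      (case k of 0 \<Rightarrow> 0 | Suc i \<Rightarrow> S i) + b' k * S k + l (Suc k) * S (Suc k)" for k
    unfolding eq S_def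
    by (cases k) (simp_all add: sum.distrib sum_distrib_left algebra_simps)
  \<comment> \<open>The summand with \<open>j = n\<close> vanishes unless \<open>k = 0\<close>,
    where it accounts for \<open>b 0\<close> in place of \<open>b' 0\<close>.\<close>
  have "motzkin b l (Suc n) k = motzkin b' l (Suc n) k +
      (b 0 - b' 0) * ((case k of 0 \<Rightarrow> 0 | Suc i \<Rightarrow> S i) + b' k * S k + l (Suc k) * S (Suc k))
      + (b 0 - b' 0) * (motzkin b l n 0 * motzkin b' l 0 k)"
  proof (cases k)
    case 0
    show ?thesis by (simp add: 0 IH[of "Suc 0"] algebra_simps) (simp add: IH[of 0] algebra_simps)
  next
    case (Suc i)
    then show ?thesis by (simp add: IH assms algebra_simps)
  qed
  then show ?case by (simp add: S_Suc algebra_simps)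
qed

text \<open>These are the coefficients of powers in the monic Laguerre polynomials with parameter
  \<open>a - 1\<close>; at \<open>k = 0\<close> they give the rising factorials that also count
  permutations by right-to-left minima.\<close>

lemma motzkin_laguerre:
  fixes a :: "'a::field_char_0"
  shows "motzkin (\<lambda>n. a + 2 * of_nat n) (\<lambda>n. of_nat n * (of_nat n + a - 1)) n k =
    of_nat (n choose k) * pochhammer (a + of_nat k) (n - k)"
proof (induction n arbitrary: k)
  case 0
  show ?case by (cases k) auto
next
  case (Suc n)
  consider "k > Suc n" | "k = Suc n" | "k = n" | "k < n" by linarith
  then show ?case
  proof cases
    case 1
    then show ?thesis by (simp add: Suc.IH binomial_eq_0 split: nat.splits)
  next
    case 2
    then show ?thesis by (simp add: Suc.IH binomial_eq_0)
  next
    case 3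
    show ?thesis
      unfolding motzkin.simps Suc.IH
      by (cases n) (simp_all add: 3 binomial_eq_0 pochhammer_Suc algebra_simps)
  next
    case 4
    then obtain d where n: "n = Suc (k + d)"
      by (metis less_iff_Suc_add)
    \<comment> \<open>All terms of the recursion share the factor \<open>(a + of_nat k) * Q\<close>,
      once the factor \<open>a + of_nat k\<close> of the subdiagonal entry is used.\<close>
    define Q where "Q = pochhammer (a + of_nat k + 1) d"
    have p1: "pochhammer (a + of_nat k) (n - k) = (a + of_nat k) * Q"
      by (simp add: n Q_def pochhammer_rec)
    have p2: "pochhammer (a + of_nat k) (Suc n - k) = (a + of_nat k) * Q * (a + of_nat n)"
    proof -
      have "Suc n - k = Suc (Suc d)" by (simp add: n)
      then show ?thesis
        by (simp only: pochhammer_Suc[of _ "Suc d"]) (simp add: pochhammer_rec Q_def n algebra_simps)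
    qed
    have p3: "pochhammer (a + of_nat (Suc k)) (n - Suc k) = Q"
      by (simp add: n Q_def algebra_simps)
    have b1: "of_nat (Suc k) * of_nat (n choose Suc k) = (of_nat n - of_nat k) * (of_nat (n choose k) :: 'a)"
    proof -
      have "Suc k * (n choose Suc k) = (n - k) * (n choose k)"
        by (rule trans[OF binomial_absorption binomial_absorb_comp[symmetric]])
      then have "of_nat (Suc k * (n choose Suc k)) = (of_nat ((n - k) * (n choose k)) :: 'a)"
        by (rule arg_cong)
      then show ?thesis using 4 by (simp only: of_nat_mult of_nat_diff less_imp_le)
    qed
    show ?thesis
    proof (cases k)
      case 0
      then show ?thesis
        unfolding motzkin.simps Suc.IH p1 p2 p3 using b1 by (simp add: algebra_simps)
    next
      case (Suc i)
      have p4: "pochhammer (a + of_nat i) (n - i) = (a + of_nat i) * (a + of_nat k) * Q"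
      proof -
        have "n - i = Suc (n - k)" using 4 Suc by simp
        then show ?thesis using p1 by (simp add: pochhammer_rec Suc algebra_simps)
      qed
      have b2: "of_nat k * of_nat (n choose k) = (of_nat n - of_nat i) * (of_nat (n choose i) :: 'a)"
      proof -
        have "Suc i * (n choose Suc i) = (n - i) * (n choose i)"
          by (rule trans[OF binomial_absorption binomial_absorb_comp[symmetric]])
        then have "of_nat (Suc i * (n choose Suc i)) = (of_nat ((n - i) * (n choose i)) :: 'a)"
          by (rule arg_cong)
        then show ?thesis using 4 Suc by (simp only: of_nat_mult of_nat_diff less_imp_le)
      qed
      define x y z :: 'a where "x = of_nat (n choose k)" and "y = of_nat (n choose i)"
        and "z = of_nat (n choose Suc k)"
      have k: "(of_nat k :: 'a) = of_nat i + 1" by (simp add: Suc)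
      \<comment> \<open>What remains without the common factor is linear in binomial coefficients;
        \<open>x + y\<close> is \<open>Suc n choose k\<close> by Pascal's rule.\<close>
      have "(x + y) * (a + of_nat n) = y * (a + of_nat i) + (a + 2 * of_nat k) * x
          + of_nat (Suc k) * z"
        using b1 b2 unfolding x_def[symmetric] y_def[symmetric] z_def[symmetric] k by algebra
      then have "(x + y) * ((a + of_nat k) * Q * (a + of_nat n)) =
          y * ((a + of_nat i) * (a + of_nat k) * Q) + (a + 2 * of_nat k) * (x * ((a + of_nat k) * Q))
          + of_nat (Suc k) * (of_nat (Suc k) + a - 1) * (z * Q)"
        by (simp add: k) algebra
      then show ?thesis
        unfolding motzkin.simps Suc.IH p1 p2 p3 x_def y_def z_def
        by (simp add: p4 Suc add.commute)
    qed
  qed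
qed

subsection \<open>Three-term recurrences and orthogonality\<close>

lemma moment_functional_0 [simp]: "moment_functional \<mu> 0 = 0"
  by (simp add: moment_functional_def)

lemma moment_functional_sum:
  "moment_functional \<mu> (\<Sum>x\<in>A. f x) = (\<Sum>x\<in>A. moment_functional \<mu> (f x))"
  by (induction A rule: infinite_finite_induct) (simp_all add: moment_functional_add)

lemma moment_functional_diff:
  "moment_functional \<mu> (p - q) = moment_functional \<mu> p - moment_functional \<mu> q"
  using moment_functional_add[of \<mu> p "smult (- 1) q"]
    moment_functional_smult[of \<mu> "- 1" q] by simp

text \<open>Since \<open>l 0 = 0\<close>, the truncated index \<open>n - 1\<close> does no harm at \<open>n = 0\<close>.\<close>

locale three_term_recurrence =
  fixes X :: "'a::comm_ring_1 poly" and P :: "nat \<Rightarrow> 'a poly" and b l :: "nat \<Rightarrow> 'a"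
  assumes P_0: "P 0 = 1"
    and l_0: "l 0 = 0"
    and X_mult: "X * P n = P (Suc n) + smult (b n) (P n) + smult (l n) (P (n - 1))"
begin

text \<open>Carries \<open>X\<close> to the other factor, which lowers the index of the first factor
  in a product \<open>P m * P n\<close>.\<close>

lemma P_Suc_mult:
  "P (Suc n) * q = P n * (X * q) - smult (b n) (P n * q) - smult (l n) (P (n - 1) * q)"
proof -
  have "P (Suc n) = X * P n - smult (b n) (P n) - smult (l n) (P (n - 1))"
    by (simp add: X_mult)
  then show ?thesis by (simp only: left_diff_distrib right_diff_distrib mult_smult_left
      mult_smult_right mult_ac)
qed

text \<open>Relative to the family \<open>P\<close>, multiplication by \<open>X\<close> acts by the
  tridiagonal matrix, and \<open>motzkin\<close> is row 0 of its powers because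
  \<open>P 0 = 1\<close>.\<close>

lemma X_power: "X ^ n = (\<Sum>k\<le>n. smult (motzkin b l n k) (P k))"
proof (induction n)
  case 0
  show ?case by (simp add: P_0)
next
  case (Suc n)
  let ?h = "motzkin b l n"
  have "X ^ Suc n = (\<Sum>k\<le>n. smult (?h k) (X * P k))"
    by (simp add: Suc.IH sum_distrib_left)
  also have "\<dots> = (\<Sum>k\<le>n. smult (?h k) (P (Suc k))) + (\<Sum>k\<le>n. smult (b k * ?h k) (P k))
      + (\<Sum>k\<le>n. smult (l k * ?h k) (P (k - 1)))"
    by (simp add: X_mult sum.distrib smult_add_right mult.commute)
  also have "(\<Sum>k\<le>n. smult (?h k) (P (Suc k))) =
      (\<Sum>k\<le>Suc n. smult (case k of 0 \<Rightarrow> 0 | Suc j \<Rightarrow> ?h j) (P k))"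
    by (subst sum.atMost_Suc_shift) simp
  also have "(\<Sum>k\<le>n. smult (b k * ?h k) (P k)) = (\<Sum>k\<le>Suc n. smult (b k * ?h k) (P k))"
    by (simp add: motzkin_eq_0)
  \<comment> \<open>Two vanishing summands are added so that the shifted sum ends at
    \<open>Suc n\<close>; the summand at index 0 then drops out by \<open>l_0\<close>.\<close>
  also have "(\<Sum>k\<le>n. smult (l k * ?h k) (P (k - 1))) =
      (\<Sum>k\<le>Suc (Suc n). smult (l k * ?h k) (P (k - 1)))"
    by (simp add: motzkin_eq_0)
  also have "\<dots> = (\<Sum>k\<le>Suc n. smult (l (Suc k) * ?h (Suc k)) (P k))"
    by (subst sum.atMost_Suc_shift) (simp add: l_0)
  finally show ?case
    by (simp only: motzkin.simps smult_add_left sum.distrib)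
qed

text \<open>In the image of \<open>X_power\<close> under the functional, induction leaves only
  \<open>k = 0\<close> and \<open>k = n\<close>. The former already equals the left side, and the
  latter has coefficient 1.\<close>

lemma moment_functional_P_eq_0:
  assumes "\<And>n. moment_functional \<mu> (X ^ n) = motzkin b l n 0" and "n > 0"
  shows "moment_functional \<mu> (P n) = 0"
  using \<open>n > 0\<close>
proof (induction n rule: less_induct)
  case (less n)
  have "motzkin b l n 0 = moment_functional \<mu> (X ^ n)" by (simp add: assms(1))
  also have "\<dots> = (\<Sum>k\<le>n. motzkin b l n k * moment_functional \<mu> (P k))"
    by (simp add: X_power moment_functional_sum moment_functional_smult)
  also have "\<dots> = (\<Sum>k\<in>{0, n}. motzkin b l n k * moment_functional \<mu> (P k))"
    using less by (intro sum.mono_neutral_right) auto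
  also have "\<dots> = motzkin b l n 0 + moment_functional \<mu> (P n)"
    using less.prems assms(1)[of 0] by (simp add: motzkin_diag P_0)
  finally show ?case by simp
qed

text \<open>Expanding \<open>X\<close> first on one factor and then on the other leads only to pairs
  with a smaller first index that is still below the second.\<close>

lemma moment_functional_P_mult_less:
  assumes "\<And>n. moment_functional \<mu> (X ^ n) = motzkin b l n 0" and "m < n"
  shows "moment_functional \<mu> (P m * P n) = 0"
  using \<open>m < n\<close>
proof (induction m arbitrary: n rule: less_induct)
  case (less m)
  show ?case
  proof (cases m)
    case 0
    then show ?thesis using less.prems by (simp add: P_0 moment_functional_P_eq_0[OF assms(1)])
  next
    case (Suc j)
    have "P m * P n = P j * (X * P n) - smult (b j) (P j * P n) - smult (l j) (P (j - 1) * P n)"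
      unfolding Suc by (rule P_Suc_mult)
    also have "P j * (X * P n) = P j * P (Suc n) + smult (b n) (P j * P n)
        + smult (l n) (P j * P (n - 1))"
      by (simp add: X_mult algebra_simps)
    finally show ?thesis
      using less.IH[of j] less.IH[of "j - 1"] less.prems Suc
      by (simp add: moment_functional_add moment_functional_diff moment_functional_smult)
  qed
qed

text \<open>Orthogonality kills every term of the two expansions but one, so each step multiplies
  the value by \<open>l (Suc n)\<close>.\<close>

lemma moment_functional_P_square:
  assumes "\<And>n. moment_functional \<mu> (X ^ n) = motzkin b l n 0"
  shows "moment_functional \<mu> (P n * P n) = (\<Prod>i=1..n. l i)"
proof (induction n)
  case 0
  show ?case using assms[of 0] by (simp add: P_0)
next
  case (Suc n)
  note orth = moment_functional_P_mult_less[OF assms]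
  have "P (Suc n) * P (Suc n) = P n * (X * P (Suc n)) - smult (b n) (P n * P (Suc n))
      - smult (l n) (P (n - 1) * P (Suc n))"
    by (rule P_Suc_mult)
  also have "P n * (X * P (Suc n)) = P n * P (Suc (Suc n)) + smult (b (Suc n)) (P n * P (Suc n))
      + smult (l (Suc n)) (P n * P n)"
    by (simp add: X_mult algebra_simps)
  finally show ?case
    by (simp add: moment_functional_add moment_functional_diff moment_functional_smult orth Suc.IH)
qed

lemma lead_coeff_P:
  assumes "degree X = 1" and "coeff X 1 = 1"
  shows "degree (P n) \<le> n \<and> coeff (P n) n = 1"
proof (induction n rule: less_induct)
  case (less n)
  show ?case
  proof (cases n)
    case 0
    then show ?thesis by (simp add: P_0)
  next
    case (Suc j)
    have P: "P n = X * P j - smult (b j) (P j) - smult (l j) (P (j - 1))"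
      using X_mult[of j] by (simp add: Suc)
    have j: "degree (P j) \<le> j" "coeff (P j) j = 1" "degree (P (j - 1)) \<le> j"
      using less[of j] less[of "j - 1"] Suc by fastforce+
    have "degree (X * P j) \<le> n"
      using degree_mult_le[of X "P j"] j assms Suc by simp
    moreover have "coeff (X * P j) n = 1"
      using coeff_mult_degree_sum[of X "P j"] j assms Suc
      by (metis (no_types, lifting) add.commute coeff_eq_0 le_neq_implies_less less_numeral_extra(1)
          mult_1 plus_1_eq_Suc zero_neq_one)
    ultimately show ?thesis
      using j Suc unfolding P
      by (auto intro!: degree_diff_le order.trans[OF degree_smult_le] simp: coeff_eq_0)
  qed
qed

end

text \<open>Raising \<open>c\<close> from 0 to 1 advances the recurrence by one index, so from
  \<open>n = 2\<close> on both summands obey the same recurrence in \<open>x + 1\<close>. The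
  multiple \<open>a - 1\<close> of the associated polynomials changes the first diagonal entry from
  \<open>a\<close> to 1.\<close>

lemma derangement_ops_three_term:
  fixes a :: "'a::comm_ring_1"
  shows "three_term_recurrence [:1, 1:] (derangement_ops a)
    (\<lambda>n. if n = 0 then 1 else a + 2 * of_nat n) (\<lambda>n. of_nat n * (of_nat n + a - 1))"
proof
  show "derangement_ops a 0 = 1" by (simp add: derangement_ops_def pcompose_1)
next
  show "of_nat 0 * (of_nat 0 + a - 1) = 0" by simp
next
  fix n
  \<comment> \<open>Below \<open>n = 2\<close> the index \<open>n - 2\<close> of the associated
    polynomials would be negative.\<close>
  consider "n = 0" | "n = 1" | m where "n = Suc (Suc m)"
    by (metis One_nat_def not0_implies_Suc)
  then show "[:1, 1:] * derangement_ops a n = derangement_ops a (Suc n)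
      + smult (if n = 0 then 1 else a + 2 * of_nat n) (derangement_ops a n)
      + smult (of_nat n * (of_nat n + a - 1)) (derangement_ops a (n - 1))"
  proof cases
    case 1
    then show ?thesis
      by (simp add: derangement_ops_def pcompose_pCons one_pCons)
  next
    case 2
    then show ?thesis
      by (simp add: derangement_ops_def pcompose_pCons pcompose_diff pcompose_mult
          pcompose_smult one_pCons algebra_simps)
  next
    case (3 m)
    define X :: "'a poly" where "X = [:1, 1:]"
    define L where "L k = pcompose (laguerre (a - 1) k) X" for k
    define A where "A k = pcompose (assoc_laguerre (a - 1) 1 k) X" for k
    define \<beta> lam :: "'a poly" where "\<beta> = [:a + 2 * of_nat n:]"
      and "lam = [:of_nat n * (of_nat n + a - 1):]"
    have lin: "pcompose [:c, 1:] X = X + [:c:]" for c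
      by (simp add: pcompose_pCons X_def)
    have \<beta>: "X + [:- (a - 1 + 2 * of_nat (Suc (Suc m)) + 1):] = X - \<beta>"
      by (simp add: \<beta>_def 3)
    have L: "L (Suc n) = (X - \<beta>) * L n - lam * L (n - 1)"
      unfolding 3 L_def laguerre.simps(3)[of _ "Suc m"] pcompose_diff pcompose_mult
        pcompose_smult lin \<beta>
      by (simp add: 3 lam_def algebra_simps del: laguerre.simps)
    have \<beta>': "X + [:- (a - 1 + 2 * of_nat (Suc m) + 2 * 1 + 1):] = X - \<beta>"
      by (simp add: \<beta>_def 3)
    have A: "A n = (X - \<beta>) * A (n - 1) - lam * A (n - 2)"
      unfolding 3 A_def assoc_laguerre.simps(3)[of _ _ m] pcompose_diff pcompose_mult
        pcompose_smult lin \<beta>'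
      by (simp add: 3 lam_def algebra_simps del: assoc_laguerre.simps)
    have D: "derangement_ops a (Suc k) = L (Suc k) + smult (a - 1) (A k)" for k
      by (simp add: derangement_ops_def L_def A_def X_def)
    have "derangement_ops a (Suc n) = L (Suc n) + smult (a - 1) (A n)"
      "derangement_ops a n = L n + smult (a - 1) (A (n - 1))"
      "derangement_ops a (n - 1) = L (n - 1) + smult (a - 1) (A (n - 2))"
      using D[of n] D[of "Suc m"] D[of m] by (simp_all add: 3)
    then have "X * derangement_ops a n = derangement_ops a (Suc n) + \<beta> * derangement_ops a n
        + lam * derangement_ops a (n - 1)"
      unfolding L A by (simp add: algebra_simps smult_add_right smult_diff_right)
    then show ?thesis using 3 by (simp add: X_def \<beta>_def lam_def)
  qed
qed

subsection \<open>Right-to-left minima\<close>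

text \<open>Positions rather than values, in an arbitrary ordered set, so that the statistic also
  applies to the set of moved points and to the two sides of a cut.\<close>

definition rl_minima :: "'a::linorder set \<Rightarrow> ('a \<Rightarrow> 'a) \<Rightarrow> 'a set" where
  "rl_minima S \<sigma> = {i\<in>S. \<forall>k\<in>S. i < k \<longrightarrow> \<sigma> i < \<sigma> k}"

definition moved_rl_minima :: "'a::linorder set \<Rightarrow> ('a \<Rightarrow> 'a) \<Rightarrow> 'a set" where
  "moved_rl_minima S \<sigma> = {i\<in>rl_minima S \<sigma>. \<sigma> i \<noteq> i}"

text \<open>On \<open>{1..n}\<close>, this and the next two sums are F_n, M_n and D_n(a).\<close>

definition rlm_sum :: "'b::comm_ring_1 \<Rightarrow> 'a::linorder set \<Rightarrow> 'b" where
  "rlm_sum a S = (\<Sum>\<sigma> | \<sigma> permutes S. a ^ card (rl_minima S \<sigma>))"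

definition moved_rlm_sum :: "'b::comm_ring_1 \<Rightarrow> 'a::linorder set \<Rightarrow> 'b" where
  "moved_rlm_sum a S = (\<Sum>\<sigma> | \<sigma> permutes S. a ^ card (moved_rl_minima S \<sigma>))"

definition derangement_sum :: "'b::comm_ring_1 \<Rightarrow> 'a::linorder set \<Rightarrow> 'b" where
  "derangement_sum a S =
     (\<Sum>\<sigma> | \<sigma> permutes S \<and> (\<forall>i\<in>S. \<sigma> i \<noteq> i). a ^ card (rl_minima S \<sigma>))"

lemma rlm_eq_card_rl_minima:
  assumes "\<sigma> permutes {1..n}"
  shows "rlm n \<sigma> = card (rl_minima {1..n} \<sigma>)"
proof -
  have "{\<sigma> i |i. i \<in> {1..n} \<and> (\<forall>k\<in>{i<..n}. \<sigma> i < \<sigma> k)} = \<sigma> ` rl_minima {1..n} \<sigma>"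
    by (auto simp: rl_minima_def)
  then show ?thesis
    unfolding rlm_def using assms by (simp add: card_image permutes_inj_on)
qed

lemma derangement_poly_eq: "derangement_poly a n = derangement_sum a {1..n}"
  unfolding derangement_poly_def derangement_sum_def derangements_def
  by (intro sum.cong) (auto simp: rlm_eq_card_rl_minima)

subsection \<open>Invariance under order isomorphism\<close>

lemma map_permutation_eq:
  "map_permutation A f = (\<lambda>\<pi> x. if x \<in> f ` A then f (\<pi> (inv_into A f x)) else x)"
  by (auto simp: map_permutation_def restrict_id_def fun_eq_iff)

text \<open>Conjugation by an order isomorphism relabels positions and values alike, so every
  comparison keeps its outcome.\<close>

lemma rl_minima_map_permutation:
  assumes "strict_mono_on A f" and "\<sigma> permutes A"
  shows "rl_minima (f ` A) (map_permutation A f \<sigma>) = f ` rl_minima A \<sigma>"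
  using assms strict_mono_on_imp_inj_on[OF assms(1)]
  by (auto simp: rl_minima_def map_permutation_apply strict_mono_on_less permutes_in_image)

lemma moved_rl_minima_map_permutation:
  assumes "strict_mono_on A f" and "\<sigma> permutes A"
  shows "moved_rl_minima (f ` A) (map_permutation A f \<sigma>) = f ` moved_rl_minima A \<sigma>"
  using strict_mono_on_imp_inj_on[OF assms(1)] permutes_in_image[OF assms(2)]
  unfolding moved_rl_minima_def rl_minima_map_permutation[OF assms]
  by (auto simp: rl_minima_def map_permutation_apply inj_on_eq_iff)

lemma moved_rlm_sum_image:
  assumes "strict_mono_on A f"
  shows "moved_rlm_sum a (f ` A) = moved_rlm_sum a A"
proof -
  note inj = strict_mono_on_imp_inj_on[OF assms]
  have card: "card (moved_rl_minima (f ` A) (map_permutation A f \<sigma>)) = card (moved_rl_minima A \<sigma>)"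
    if "\<sigma> permutes A" for \<sigma>
    unfolding moved_rl_minima_map_permutation[OF assms that]
    by (rule card_image, rule inj_on_subset[OF inj]) (auto simp: moved_rl_minima_def rl_minima_def)
  have "moved_rlm_sum a (f ` A) =
      (\<Sum>\<sigma> | \<sigma> permutes A. a ^ card (moved_rl_minima (f ` A) (map_permutation A f \<sigma>)))"
    unfolding moved_rlm_sum_def
    by (rule sum.reindex_bij_betw[symmetric]) (unfold map_permutation_eq,
      rule bij_betw_permutations[OF inj_on_imp_bij_betw[OF inj]])
  also have "\<dots> = moved_rlm_sum a A"
    unfolding moved_rlm_sum_def by (intro sum.cong) (auto simp: card)
  finally show ?thesis .
qed

lemma derangement_sum_image:
  assumes "strict_mono_on A f"
  shows "derangement_sum a (f ` A) = derangement_sum a A"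
proof -
  note inj = strict_mono_on_imp_inj_on[OF assms]
  have card: "card (rl_minima (f ` A) (map_permutation A f \<sigma>)) = card (rl_minima A \<sigma>)"
    if "\<sigma> permutes A" for \<sigma>
    unfolding rl_minima_map_permutation[OF assms that]
    by (rule card_image, rule inj_on_subset[OF inj]) (auto simp: rl_minima_def)
  have "bij_betw (map_permutation A f) {\<pi>. \<pi> permutes A \<and> (\<forall>i\<in>A. \<pi> i \<noteq> i)}
      {\<pi>. \<pi> permutes f ` A \<and> (\<forall>i\<in>f ` A. \<pi> i \<noteq> i)}"
    unfolding map_permutation_eq by (rule bij_betw_derangements[OF inj_on_imp_bij_betw[OF inj]])
  then have "derangement_sum a (f ` A) = (\<Sum>\<sigma> | \<sigma> permutes A \<and> (\<forall>i\<in>A. \<sigma> i \<noteq> i).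
      a ^ card (rl_minima (f ` A) (map_permutation A f \<sigma>)))"
    unfolding derangement_sum_def by (rule sum.reindex_bij_betw[symmetric])
  also have "\<dots> = derangement_sum a A"
    unfolding derangement_sum_def by (intro sum.cong) (auto simp: card)
  finally show ?thesis .
qed

lemma derangement_sum_card:
  fixes S T :: "nat set"
  assumes "finite S" and "finite T" and "card S = card T"
  shows "derangement_sum a S = derangement_sum a T"
proof -
  have "derangement_sum a S = derangement_sum a {..<card S}" if "finite S" for S :: "nat set"
    using ex_bij_betw_strict_mono_card[OF that] derangement_sum_image
    by (metis bij_betw_imp_surj_on)
  from this[OF assms(1)] this[OF assms(2)] show ?thesis by (simp add: assms(3))
qed

text \<open>Relabels the block to the right of a cut.\<close>

lemma moved_rlm_sum_atLeastAtMost: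
  "moved_rlm_sum a {Suc m..m + n} = moved_rlm_sum a {1..n}"
proof -
  have "{Suc m..m + n} = (+) m ` {1..n}"
    by (simp add: image_add_atLeastAtMost)
  moreover have "strict_mono_on {1..n} ((+) m)"
    by (auto intro: strict_mono_onI)
  ultimately show ?thesis using moved_rlm_sum_image by metis
qed

subsection \<open>Removing fixed points\<close>

text \<open>
  A fixed point \<open>k > i\<close> with \<open>k < \<sigma> i\<close> can be ignored: by the pigeonhole principle
  some value below \<open>k\<close> occurs to its right, at a position which is not fixed.
\<close>

lemma moved_rl_minima_eq:
  fixes \<sigma> :: "'a::linorder \<Rightarrow> 'a"
  assumes "finite S" and "\<sigma> permutes S"
  shows "moved_rl_minima S \<sigma> = rl_minima {i\<in>S. \<sigma> i \<noteq> i} \<sigma>"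
proof (intro equalityI subsetI)
  fix i assume "i \<in> moved_rl_minima S \<sigma>"
  then show "i \<in> rl_minima {i\<in>S. \<sigma> i \<noteq> i} \<sigma>"
    by (auto simp: moved_rl_minima_def rl_minima_def)
next
  fix i assume i: "i \<in> rl_minima {i\<in>S. \<sigma> i \<noteq> i} \<sigma>"
  have "\<sigma> i < \<sigma> k" if k: "k \<in> S" "i < k" for k
  proof (rule ccontr)
    assume "\<not> \<sigma> i < \<sigma> k"
    with i k have fix_k: "\<sigma> k = k" by (auto simp: rl_minima_def)
    let ?U = "{j\<in>S. k \<le> j}"
    have "\<sigma> i \<noteq> \<sigma> k" using that permutes_inj[OF assms(2)] by (auto dest: injD)
    with \<open>\<not> \<sigma> i < \<sigma> k\<close> fix_k have "k < \<sigma> i" by simp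
    \<comment> \<open>A value below \<open>k\<close> at such a \<open>j\<close> would make
      \<open>j\<close> a moved point to the right of \<open>i\<close> with a smaller value. Hence
      \<open>\<sigma>\<close> maps \<open>?U\<close> onto itself, which is impossible as
      \<open>\<sigma> i\<close> lies in \<open>?U\<close> and \<open>i\<close> does not.\<close>
    have "\<sigma> j \<in> ?U" if j: "j \<in> ?U" for j
    proof (rule ccontr)
      assume "\<sigma> j \<notin> ?U"
      with j have "\<sigma> j < k" using permutes_in_image[OF assms(2)] by auto
      with j have "\<sigma> j \<noteq> j" "i < j" using k by auto
      with i j have "\<sigma> i < \<sigma> j" by (auto simp: rl_minima_def)
      with \<open>\<sigma> j < k\<close> \<open>k < \<sigma> i\<close> show False by simp
    qed
    then have "\<sigma> ` ?U = ?U"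
      using assms permutes_inj_on[OF assms(2)] by (intro endo_inj_surj) auto
    moreover have "\<sigma> i \<in> ?U"
      using i \<open>k < \<sigma> i\<close> permutes_in_image[OF assms(2)] by (auto simp: rl_minima_def)
    ultimately have "\<sigma> i \<in> \<sigma> ` ?U" by simp
    then have "i \<in> ?U" using permutes_inj[OF assms(2)] by (auto dest: injD)
    with k show False by (auto dest: leD)
  qed
  with i show "i \<in> moved_rl_minima S \<sigma>"
    by (auto simp: moved_rl_minima_def rl_minima_def)
qed

lemma permutes_support_eq_iff:
  assumes "T \<subseteq> S"
  shows "\<sigma> permutes S \<and> {i\<in>S. \<sigma> i \<noteq> i} = T \<longleftrightarrow> \<sigma> permutes T \<and> (\<forall>i\<in>T. \<sigma> i \<noteq> i)"
proof
  assume "\<sigma> permutes S \<and> {i\<in>S. \<sigma> i \<noteq> i} = T"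
  then show "\<sigma> permutes T \<and> (\<forall>i\<in>T. \<sigma> i \<noteq> i)"
    by (auto intro: permutes_superset)
next
  assume \<sigma>: "\<sigma> permutes T \<and> (\<forall>i\<in>T. \<sigma> i \<noteq> i)"
  then have "x \<in> T" if "\<sigma> x \<noteq> x" for x
    using permutes_not_in[of \<sigma> T x] that by blast
  with \<sigma> show "\<sigma> permutes S \<and> {i\<in>S. \<sigma> i \<noteq> i} = T"
    using assms by (auto intro: permutes_subset)
qed

text \<open>By \<open>moved_rl_minima_eq\<close> the weight depends only on the restriction to the
  moved points, on which the permutation is a derangement; the sum is grouped by the set
  \<open>T\<close> of these points.\<close>

lemma moved_rlm_sum_eq_sum_Pow:
  assumes "finite S"
  shows "moved_rlm_sum a S = (\<Sum>T\<in>Pow S. derangement_sum a T)"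
proof -
  have "moved_rlm_sum a S = (\<Sum>T\<in>Pow S. \<Sum>\<sigma> | \<sigma> \<in> {\<sigma>. \<sigma> permutes S} \<and> {i\<in>S. \<sigma> i \<noteq> i} = T.
      a ^ card (moved_rl_minima S \<sigma>))"
    unfolding moved_rlm_sum_def
    by (rule sum.group[symmetric]) (use assms in \<open>auto simp: finite_permutations\<close>)
  also have "\<dots> = (\<Sum>T\<in>Pow S. derangement_sum a T)"
    unfolding derangement_sum_def
    by (intro sum.cong)
      (auto simp: permutes_support_eq_iff[symmetric] moved_rl_minima_eq assms)
  finally show ?thesis .
qed

text \<open>Grouping the sets of moved points by cardinality gives the binomial transform, that is,
  the moments in the variable \<open>x + 1\<close>.\<close>

lemma moved_rlm_sum_binomial:
  "moved_rlm_sum a {1..n} = (\<Sum>k\<le>n. of_nat (n choose k) * derangement_poly a k)"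
proof -
  have "moved_rlm_sum a {1..n} =
      (\<Sum>k\<le>n. \<Sum>T | T \<in> Pow {1..n} \<and> card T = k. derangement_sum a T)"
    unfolding moved_rlm_sum_eq_sum_Pow[OF finite_atLeastAtMost]
    by (rule sum.group[symmetric]) (auto dest: card_mono[rotated])
  also have "\<dots> = (\<Sum>k\<le>n. \<Sum>T | T \<subseteq> {1..n} \<and> card T = k. derangement_poly a k)"
    unfolding derangement_poly_eq
    by (intro sum.cong refl derangement_sum_card) (auto intro: finite_subset)
  also have "\<dots> = (\<Sum>k\<le>n. of_nat (n choose k) * derangement_poly a k)"
    by (simp add: n_subsets)
  finally show ?thesis .
qed

subsection \<open>All permutations\<close>

fun rl_minima_count :: "'a::linorder list \<Rightarrow> nat" where
  "rl_minima_count [] = 0"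
| "rl_minima_count (x # xs) = (if \<forall>y\<in>set xs. x < y then 1 else 0) + rl_minima_count xs"

text \<open>The first entry is a right-to-left minimum exactly when it is \<open>Min A\<close>,
  whatever the order of the rest. With \<open>n\<close> further entries, its choice contributes the
  factor \<open>a + of_nat n\<close>.\<close>

lemma sum_rl_minima_count:
  fixes A :: "'a::linorder set" and a :: "'b::comm_ring_1"
  assumes "finite A"
  shows "(\<Sum>xs\<in>permutations_of_set A. a ^ rl_minima_count xs) = pochhammer a (card A)"
  using assms
proof (induction "card A" arbitrary: A)
  case 0
  then show ?case by simp
next
  case (Suc n)
  then have "A \<noteq> {}" by auto
  let ?w = "\<lambda>xs. a ^ rl_minima_count xs"
  have step: "(\<Sum>xs\<in>(#) x ` permutations_of_set (A - {x}). ?w xs) =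
      (if x = Min A then a else 1) * pochhammer a n" if x: "x \<in> A" for x
  proof -
    have iff: "(\<forall>y\<in>A - {x}. x < y) \<longleftrightarrow> x = Min A"
      using x Suc.prems by (auto simp: eq_Min_iff[OF _ \<open>A \<noteq> {}\<close>] order.strict_iff_order)
    have "(\<Sum>xs\<in>(#) x ` permutations_of_set (A - {x}). ?w xs) =
        (\<Sum>xs\<in>permutations_of_set (A - {x}). ?w (x # xs))"
      by (subst sum.reindex) auto
    also have "\<dots> = (\<Sum>xs\<in>permutations_of_set (A - {x}). (if x = Min A then a else 1) * ?w xs)"
      by (intro sum.cong) (auto simp: iff permutations_of_setD)
    also have "\<dots> = (if x = Min A then a else 1) * pochhammer a n"
    proof -
      have "card (A - {x}) = n" using Suc x by simp
      then show ?thesis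
        using Suc.hyps(1)[of "A - {x}"] Suc.prems by (simp add: sum_distrib_left[symmetric])
    qed
    finally show ?thesis .
  qed
  have "(\<Sum>xs\<in>permutations_of_set A. ?w xs) =
      (\<Sum>x\<in>A. \<Sum>xs\<in>(#) x ` permutations_of_set (A - {x}). ?w xs)"
    unfolding permutations_of_set_nonempty[OF \<open>A \<noteq> {}\<close>]
    by (rule sum.UNION_disjoint) (use Suc.prems in auto)
  also have "\<dots> = (\<Sum>x\<in>A. if x = Min A then a else 1) * pochhammer a n"
    by (simp add: step sum_distrib_right)
  also have "(\<Sum>x\<in>A. if x = Min A then a else 1) = a + of_nat n"
    using Suc.prems \<open>A \<noteq> {}\<close>
    by (subst sum.remove[of _ "Min A"]) (simp_all flip: Suc.hyps(2))
  finally show ?case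
    using Suc.hyps(2) by (simp add: pochhammer_Suc flip: Suc.hyps(2))
qed

lemma rl_minima_count_map:
  "rl_minima_count (map \<sigma> [m..<Suc n]) = card (rl_minima {m..n} \<sigma>)"
proof (induction "Suc n - m" arbitrary: m)
  case 0
  then show ?case by (simp add: rl_minima_def)
next
  case (Suc d)
  then have "m \<le> n" by simp
  have "rl_minima {m..n} \<sigma> = (if \<forall>k\<in>{Suc m..n}. \<sigma> m < \<sigma> k then {m} else {})
      \<union> rl_minima {Suc m..n} \<sigma>"
    using \<open>m \<le> n\<close> by (auto simp: rl_minima_def Suc_le_eq le_less)
  moreover have "m \<notin> rl_minima {Suc m..n} \<sigma>" "finite (rl_minima {Suc m..n} \<sigma>)"
    by (simp_all add: rl_minima_def)
  moreover have "[m..<Suc n] = m # [Suc m..<Suc n]" using \<open>m \<le> n\<close> by (simp add: upt_conv_Cons)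
  moreover have "set [Suc m..<Suc n] = {Suc m..n}" by auto
  ultimately show ?case
    using Suc(1)[of "Suc m"] Suc(2) by simp
qed

lemma rlm_sum_eq_pochhammer: "rlm_sum a {1..n} = pochhammer a n"
proof -
  let ?f = "\<lambda>\<sigma>. map \<sigma> [1..<Suc n]"
  have inj: "inj_on ?f {\<sigma>. \<sigma> permutes {1..n}}"
  proof (intro inj_onI ext)
    fix \<sigma> \<tau> x assume *: "\<sigma> \<in> {\<sigma>. \<sigma> permutes {1..n}}" "\<tau> \<in> {\<sigma>. \<sigma> permutes {1..n}}" "?f \<sigma> = ?f \<tau>"
    show "\<sigma> x = \<tau> x"
      using * by (cases "x \<in> {1..n}") (auto simp: permutes_not_in simp del: upt_Suc)
  qed
  have "set (?f \<sigma>) = {1..n} \<and> distinct (?f \<sigma>)" if "\<sigma> permutes {1..n}" for \<sigma>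
  proof -
    have "set [1..<Suc n] = {1..n}" by auto
    then show ?thesis
      using permutes_image[OF that] permutes_inj_on[OF that]
      by (simp add: distinct_map del: upt_Suc)
  qed
  then have "?f ` {\<sigma>. \<sigma> permutes {1..n}} \<subseteq> permutations_of_set {1..n}"
    by (auto simp: permutations_of_set_def simp del: upt_Suc)
  \<comment> \<open>Both sets have \<open>n!\<close> elements, so passing to one-line notation is
    onto.\<close>
  moreover have "card (?f ` {\<sigma>. \<sigma> permutes {1..n}}) = card (permutations_of_set {1..n})"
    unfolding card_image[OF inj] by (simp add: card_permutations)
  ultimately have "?f ` {\<sigma>. \<sigma> permutes {1..n}} = permutations_of_set {1..n}"
    by (intro card_subset_eq) auto
  then have "(\<Sum>xs\<in>permutations_of_set {1..n}. a ^ rl_minima_count xs) =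
      (\<Sum>\<sigma> | \<sigma> permutes {1..n}. a ^ rl_minima_count (?f \<sigma>))"
    using sum.reindex[OF inj, of "\<lambda>xs. a ^ rl_minima_count xs"] by (simp del: upt_Suc)
  then show ?thesis
    by (simp only: rl_minima_count_map sum_rl_minima_count[OF finite_atLeastAtMost] rlm_sum_def) simp
qed

subsection \<open>Splitting at a fixed right-to-left minimum\<close>

text \<open>To be applied with \<open>R\<close> the right-to-left minima and \<open>X\<close> the
  fixed ones among them; each \<open>f\<close> in \<open>X\<close> contributes the change of its own
  factor from 1 to \<open>a\<close>.\<close>

lemma power_diff_telescope:
  fixes a :: "'b::comm_ring_1" and R X :: "nat set"
  assumes "R \<subseteq> {1..n}" and "X \<subseteq> R"
  shows "a ^ card R - a ^ card (R - X) =
    (a - 1) * (\<Sum>f\<in>X. a ^ card (R \<inter> {1..<f}) * a ^ card ((R - X) \<inter> {f<..n}))"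
proof -
  \<comment> \<open>Interpolates between the two powers: up to \<open>j\<close> all of
    \<open>R\<close> is counted, beyond \<open>j\<close> only \<open>R - X\<close>.\<close>
  define g where "g j = a ^ card (R \<inter> {1..j}) * a ^ card ((R - X) \<inter> {j<..n})" for j
  have step: "g (Suc j) - g j = (if Suc j \<in> X then
      (a - 1) * (a ^ card (R \<inter> {1..<Suc j}) * a ^ card ((R - X) \<inter> {Suc j<..n})) else 0)"
    if j: "j < n" for j
  proof -
    have l: "R \<inter> {1..Suc j} = (if Suc j \<in> R then insert (Suc j) (R \<inter> {1..j}) else R \<inter> {1..j})"
      by (auto simp: le_Suc_eq)
    have r: "(R - X) \<inter> {j<..n} = (if Suc j \<in> R - X
        then insert (Suc j) ((R - X) \<inter> {Suc j<..n}) else (R - X) \<inter> {Suc j<..n})"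
    proof -
      have "{j<..n} = insert (Suc j) {Suc j<..n}" using j by auto
      then show ?thesis by auto
    qed
    have e: "{1..<Suc j} = {1..j}" by auto
    have f: "finite (R \<inter> {1..j})" "finite ((R - X) \<inter> {Suc j<..n})" by auto
    show ?thesis
      using assms(2) f unfolding g_def l r e by (auto simp: algebra_simps)
  qed
  have "R \<inter> {1..n} = R" "(R - X) \<inter> {0<..n} = R - X"
    using assms(1) by auto
  then have "a ^ card R - a ^ card (R - X) = g n - g 0"
    by (simp add: g_def)
  also have "\<dots> = (\<Sum>j<n. g (Suc j) - g j)" by (simp add: sum_lessThan_telescope)
  also have "\<dots> = (\<Sum>j<n. if Suc j \<in> X then
      (a - 1) * (a ^ card (R \<inter> {1..<Suc j}) * a ^ card ((R - X) \<inter> {Suc j<..n})) else 0)"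
    by (intro sum.cong) (auto simp: step)
  also have "\<dots> = (\<Sum>f\<in>{1..n}. if f \<in> X then
      (a - 1) * (a ^ card (R \<inter> {1..<f}) * a ^ card ((R - X) \<inter> {f<..n})) else 0)"
    by (rule sum.reindex_bij_witness[of _ "\<lambda>f. f - 1" Suc]) auto
  also have "\<dots> = (\<Sum>f\<in>X. (a - 1) * (a ^ card (R \<inter> {1..<f}) * a ^ card ((R - X) \<inter> {f<..n})))"
    using assms by (intro sum.mono_neutral_cong_right) auto
  finally show ?thesis by (simp add: sum_distrib_left)
qed

text \<open>A right-to-left minimum fixed at \<open>f\<close> forces all values to its right above
  \<open>f\<close>, so the permutation is a pair of independent permutations of the two sides and
  the weight factors.\<close>

lemma sum_permutes_split:
  fixes a :: "'b::comm_ring_1" and f n :: nat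
  assumes f: "f \<in> {1..n}"
  shows "(\<Sum>\<sigma> | \<sigma> permutes {1..n} \<and> f \<in> rl_minima {1..n} \<sigma> \<and> \<sigma> f = f.
      a ^ card (rl_minima {1..n} \<sigma> \<inter> {1..<f}) * a ^ card (moved_rl_minima {1..n} \<sigma> \<inter> {f<..n})) =
    rlm_sum a {1..<f} * moved_rlm_sum a {f<..n}"
proof -
  define L where "L \<sigma> x = (if x < f then \<sigma> x else x)" for \<sigma> :: "nat \<Rightarrow> nat" and x
  define R where "R \<sigma> x = (if f < x then \<sigma> x else x)" for \<sigma> :: "nat \<Rightarrow> nat" and x
  let ?S = "{\<sigma>. \<sigma> permutes {1..n} \<and> f \<in> rl_minima {1..n} \<sigma> \<and> \<sigma> f = f}"
  have right: "\<sigma> x \<in> {f<..n}" if "\<sigma> \<in> ?S" "x \<in> {f<..n}" for \<sigma> x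
    using that permutes_in_image[of \<sigma> "{1..n}" x] f by (auto simp: rl_minima_def)
  \<comment> \<open>By finiteness the positions after \<open>f\<close> use up all values above
    \<open>f\<close>, so no earlier position takes one of them.\<close>
  have left: "\<sigma> x \<in> {1..<f}" if \<sigma>: "\<sigma> \<in> ?S" and x: "x \<in> {1..<f}" for \<sigma> x
  proof (rule ccontr)
    assume "\<sigma> x \<notin> {1..<f}"
    have inj: "inj \<sigma>" using \<sigma> permutes_inj by auto
    have "\<sigma> x \<in> {1..n}" using \<sigma> x f permutes_in_image[of \<sigma> "{1..n}" x] by auto
    moreover have "\<sigma> x \<noteq> f" using \<sigma> x injD[OF inj, of x f] by auto
    ultimately have "\<sigma> x \<in> {f<..n}" using \<open>\<sigma> x \<notin> {1..<f}\<close> by auto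
    also have "{f<..n} = \<sigma> ` {f<..n}"
      using right[OF \<sigma>] inj by (intro endo_inj_surj[symmetric]) (auto intro: inj_on_subset)
    finally show False using x injD[OF inj] by fastforce
  qed
  have L: "L \<sigma> permutes {1..<f}" if "\<sigma> \<in> ?S" for \<sigma>
  proof (rule inj_imp_permutes)
    show "inj_on (L \<sigma>) {1..<f}"
      using that permutes_inj[of \<sigma> "{1..n}"] by (auto simp: L_def inj_on_def inj_def)
    show "L \<sigma> x \<in> {1..<f}" if "x \<in> {1..<f}" for x
      using left[OF \<open>\<sigma> \<in> ?S\<close> that] that by (simp add: L_def)
    show "L \<sigma> x = x" if "x \<notin> {1..<f}" for x
      using that permutes_not_in[of \<sigma> "{1..n}" x] \<open>\<sigma> \<in> ?S\<close> by (auto simp: L_def)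
  qed simp
  have R: "R \<sigma> permutes {f<..n}" if "\<sigma> \<in> ?S" for \<sigma>
  proof (rule inj_imp_permutes)
    show "inj_on (R \<sigma>) {f<..n}"
      using that permutes_inj[of \<sigma> "{1..n}"] by (auto simp: R_def inj_on_def inj_def)
    show "R \<sigma> x \<in> {f<..n}" if "x \<in> {f<..n}" for x
      using right[OF \<open>\<sigma> \<in> ?S\<close> that] that by (simp add: R_def)
    show "R \<sigma> x = x" if "x \<notin> {f<..n}" for x
      using that permutes_not_in[of \<sigma> "{1..n}" x] \<open>\<sigma> \<in> ?S\<close> by (auto simp: R_def)
  qed simp
  have comp: "(\<alpha> \<circ> \<beta>) x = (if x < f then \<alpha> x else \<beta> x)"
    if "\<alpha> permutes {1..<f}" "\<beta> permutes {f<..n}" for \<alpha> \<beta> x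
    using that permutes_not_in[of \<beta> "{f<..n}" x] permutes_not_in[of \<alpha> "{1..<f}" "\<beta> x"]
      permutes_in_image[of \<beta> "{f<..n}" x]
    by (cases "x \<in> {f<..n}") auto
  have comp_in: "\<alpha> \<circ> \<beta> \<in> ?S"
    if "\<alpha> permutes {1..<f}" "\<beta> permutes {f<..n}" for \<alpha> \<beta>
  proof -
    have "\<alpha> \<circ> \<beta> permutes {1..n}"
      using f by (intro permutes_compose permutes_subset[OF that(1)] permutes_subset[OF that(2)]) auto
    moreover have fix_f: "(\<alpha> \<circ> \<beta>) f = f"
      using comp[OF that, of f] permutes_not_in[OF that(2), of f] by simp
    moreover have "f < \<beta> k" if "f < k" "k \<le> n" for k
      using permutes_in_image[OF \<open>\<beta> permutes {f<..n}\<close>, of k] that by simp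
    then have "f \<in> rl_minima {1..n} (\<alpha> \<circ> \<beta>)"
      using f fix_f comp[OF that] unfolding rl_minima_def by (simp del: o_apply)
    ultimately show ?thesis by simp
  qed
  have rl: "rl_minima {1..n} \<sigma> \<inter> {1..<f} = rl_minima {1..<f} (L \<sigma>)" if \<sigma>: "\<sigma> \<in> ?S" for \<sigma>
  proof -
    \<comment> \<open>Positions from \<open>f\<close> on impose no condition on minima to the left
      of \<open>f\<close>.\<close>
    have "\<sigma> i < \<sigma> k" if i: "i \<in> {1..<f}" and k: "k \<in> {1..n}" "\<not> k < f" for i k
      using left[OF \<sigma> i] right[OF \<sigma>, of k] k \<sigma> by (cases "k = f") auto
    then show ?thesis
      using f unfolding rl_minima_def L_def by (auto simp: not_less)
  qed
  have moved: "moved_rl_minima {1..n} \<sigma> \<inter> {f<..n} = moved_rl_minima {f<..n} (R \<sigma>)"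
    if "\<sigma> \<in> ?S" for \<sigma>
    using f by (auto simp: moved_rl_minima_def rl_minima_def R_def)
  have "rlm_sum a {1..<f} * moved_rlm_sum a {f<..n} =
      (\<Sum>(\<alpha>, \<beta>)\<in>{\<alpha>. \<alpha> permutes {1..<f}} \<times> {\<beta>. \<beta> permutes {f<..n}}.
        a ^ card (rl_minima {1..<f} \<alpha>) * a ^ card (moved_rl_minima {f<..n} \<beta>))"
    by (simp add: rlm_sum_def moved_rlm_sum_def sum_product sum.cartesian_product)
  also have "\<dots> = (\<Sum>\<sigma>\<in>?S. a ^ card (rl_minima {1..n} \<sigma> \<inter> {1..<f})
      * a ^ card (moved_rl_minima {1..n} \<sigma> \<inter> {f<..n}))"
  proof (rule sum.reindex_bij_witness[of _ "\<lambda>\<sigma>. (L \<sigma>, R \<sigma>)" "\<lambda>(\<alpha>, \<beta>). \<alpha> \<circ> \<beta>"])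
    fix p assume "p \<in> {\<alpha>. \<alpha> permutes {1..<f}} \<times> {\<beta>. \<beta> permutes {f<..n}}"
    then obtain \<alpha> \<beta> where p: "p = (\<alpha>, \<beta>)" and \<alpha>: "\<alpha> permutes {1..<f}" and \<beta>: "\<beta> permutes {f<..n}"
      by auto
    have "L (\<alpha> \<circ> \<beta>) = \<alpha>" "R (\<alpha> \<circ> \<beta>) = \<beta>"
      using comp[OF \<alpha> \<beta>] permutes_not_in[OF \<alpha>] permutes_not_in[OF \<beta>]
      by (auto simp: L_def R_def fun_eq_iff simp del: o_apply)
    then show "(case case p of (\<alpha>, \<beta>) \<Rightarrow> \<alpha> \<circ> \<beta> of \<sigma> \<Rightarrow> (L \<sigma>, R \<sigma>)) = p"
      and "(case p of (\<alpha>, \<beta>) \<Rightarrow> \<alpha> \<circ> \<beta>) \<in> ?S"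
      and "a ^ card (rl_minima {1..n} (case p of (\<alpha>, \<beta>) \<Rightarrow> \<alpha> \<circ> \<beta>) \<inter> {1..<f})
          * a ^ card (moved_rl_minima {1..n} (case p of (\<alpha>, \<beta>) \<Rightarrow> \<alpha> \<circ> \<beta>) \<inter> {f<..n}) =
        (case p of (\<alpha>, \<beta>) \<Rightarrow> a ^ card (rl_minima {1..<f} \<alpha>) * a ^ card (moved_rl_minima {f<..n} \<beta>))"
      using comp_in[OF \<alpha> \<beta>] rl[OF comp_in[OF \<alpha> \<beta>]] moved[OF comp_in[OF \<alpha> \<beta>]]
      by (simp_all add: p del: o_apply)
  next
    fix \<sigma> assume \<sigma>: "\<sigma> \<in> ?S"
    show "(L \<sigma>, R \<sigma>) \<in> {\<alpha>. \<alpha> permutes {1..<f}} \<times> {\<beta>. \<beta> permutes {f<..n}}"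
      using L R \<sigma> by simp
    show "(case (L \<sigma>, R \<sigma>) of (\<alpha>, \<beta>) \<Rightarrow> \<alpha> \<circ> \<beta>) = \<sigma>"
      using comp[OF L[OF \<sigma>] R[OF \<sigma>]] \<sigma>
      by (auto simp: L_def R_def fun_eq_iff not_less le_less simp del: o_apply)
  qed
  finally show ?thesis by simp
qed

text \<open>Summing \<open>power_diff_telescope\<close> over all permutations and exchanging that
  sum with the one over the cut \<open>f\<close> reduces this to \<open>sum_permutes_split\<close>,
  with \<open>j = f - 1\<close>.\<close>

lemma rlm_sum_eq_moved_rlm_sum:
  fixes a :: "'b::comm_ring_1" and n :: nat
  shows "rlm_sum a {1..n} = moved_rlm_sum a {1..n}
     + (a - 1) * (\<Sum>j<n. rlm_sum a {1..j} * moved_rlm_sum a {1..n - 1 - j})"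
proof -
  let ?w = "\<lambda>\<sigma> f. a ^ card (rl_minima {1..n} \<sigma> \<inter> {1..<f})
    * a ^ card (moved_rl_minima {1..n} \<sigma> \<inter> {f<..n})"
  have "rlm_sum a {1..n} - moved_rlm_sum a {1..n} =
      (\<Sum>\<sigma> | \<sigma> permutes {1..n}. (a - 1) *
        (\<Sum>f | f \<in> {1..n} \<and> (f \<in> rl_minima {1..n} \<sigma> \<and> \<sigma> f = f). ?w \<sigma> f))"
    unfolding rlm_sum_def moved_rlm_sum_def sum_subtractf[symmetric]
  proof (intro sum.cong refl)
    fix \<sigma>
    let ?R = "rl_minima {1..n} \<sigma>" and ?X = "{f. f \<in> {1..n} \<and> (f \<in> rl_minima {1..n} \<sigma> \<and> \<sigma> f = f)}"
    have eq: "?R - ?X = moved_rl_minima {1..n} \<sigma>"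
      by (auto simp: moved_rl_minima_def rl_minima_def)
    have "?R \<subseteq> {1..n}" "?X \<subseteq> ?R"
      by (auto simp: rl_minima_def)
    from power_diff_telescope[OF this, of a]
    show "a ^ card ?R - a ^ card (moved_rl_minima {1..n} \<sigma>) = (a - 1) * (\<Sum>f\<in>?X. ?w \<sigma> f)"
      unfolding eq .
  qed
  also have "\<dots> = (a - 1) * (\<Sum>\<sigma>\<in>{\<sigma>. \<sigma> permutes {1..n}}.
      \<Sum>f | f \<in> {1..n} \<and> (f \<in> rl_minima {1..n} \<sigma> \<and> \<sigma> f = f). ?w \<sigma> f)"
    by (simp add: sum_distrib_left)
  also have "\<dots> = (a - 1) * (\<Sum>f\<in>{1..n}.
      \<Sum>\<sigma> | \<sigma> \<in> {\<sigma>. \<sigma> permutes {1..n}} \<and> (f \<in> rl_minima {1..n} \<sigma> \<and> \<sigma> f = f). ?w \<sigma> f)"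
    by (subst sum.swap_restrict) (simp_all add: finite_permutations)
  also have "\<dots> = (a - 1) * (\<Sum>f\<in>{1..n}. rlm_sum a {1..<f} * moved_rlm_sum a {f<..n})"
    by (simp only: mem_Collect_eq sum_permutes_split cong: sum.cong)
  also have "(\<Sum>f\<in>{1..n}. rlm_sum a {1..<f} * moved_rlm_sum a {f<..n}) =
      (\<Sum>j<n. rlm_sum a {1..j} * moved_rlm_sum a {1..n - 1 - j})"
  proof (rule sum.reindex_bij_witness[of _ Suc "\<lambda>f. f - 1"])
    fix f assume f: "f \<in> {1..n}"
    have "{1..<f} = {1..f - 1}" "{f<..n} = {Suc f..f + (n - f)}" "n - 1 - (f - 1) = n - f"
      using f by auto
    then show "rlm_sum a {1..f - 1} * moved_rlm_sum a {1..n - 1 - (f - 1)} =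
        rlm_sum a {1..<f} * moved_rlm_sum a {f<..n}"
      by (simp only: moved_rlm_sum_atLeastAtMost)
  qed auto
  finally show ?thesis by (simp add: algebra_simps)
qed

subsection \<open>Moments of the derangement polynomials\<close>

text \<open>Both sides satisfy the same relation with F_n, which determines the value at
  \<open>n\<close> from those below; the factor \<open>a - 1\<close> is the difference of the corner
  entries \<open>a\<close> and 1.\<close>

lemma moved_rlm_sum_eq_motzkin:
  fixes a :: "'a::field_char_0"
  shows "moved_rlm_sum a {1..n} = motzkin (\<lambda>n. if n = 0 then 1 else a + 2 * of_nat n)
    (\<lambda>n. of_nat n * (of_nat n + a - 1)) n 0"
    (is "_ = motzkin ?b' ?l n 0")
proof (induction n rule: less_induct)
  case (less n)
  have F: "motzkin (\<lambda>n. a + 2 * of_nat n) ?l j 0 = rlm_sum a {1..j}" for j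
    unfolding rlm_sum_eq_pochhammer motzkin_laguerre by simp
  have "rlm_sum a {1..n} = motzkin ?b' ?l n 0
      + (a - 1) * (\<Sum>j<n. rlm_sum a {1..j} * motzkin ?b' ?l (n - 1 - j) 0)"
    using motzkin_change_corner[of "\<lambda>n. a + 2 * of_nat n" ?b' ?l n 0] by (simp add: F)
  also have "(\<Sum>j<n. rlm_sum a {1..j} * motzkin ?b' ?l (n - 1 - j) 0) =
      (\<Sum>j<n. rlm_sum a {1..j} * moved_rlm_sum a {1..n - 1 - j})"
    by (intro sum.cong refl) (simp add: less.IH del: One_nat_def)
  finally show ?case
    using rlm_sum_eq_moved_rlm_sum[of a n] by simp
qed

lemma moment_functional_derangement_poly_shifted:
  fixes a :: "'a::comm_ring_1"
  shows "moment_functional (derangement_poly a) ([:1, 1:] ^ n) = moved_rlm_sum a {1..n}"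
proof -
  have "[:1, 1:] = monom 1 1 + (1 :: 'a poly)"
    by (simp add: monom_altdef one_pCons)
  then have "[:1, 1:] ^ n = (\<Sum>k\<le>n. smult (of_nat (n choose k)) (monom (1 :: 'a) k))"
    by (simp add: binomial_ring monom_power of_nat_poly smult_monom)
  then show ?thesis
    by (simp add: moment_functional_sum moment_functional_smult moment_functional_monom
        moved_rlm_sum_binomial del: One_nat_def)
qed

theorem theorem3p9:
  fixes a :: "'a::field_char_0"
  defines "\<L> \<equiv> moment_functional (derangement_poly a)"
    and "P \<equiv> derangement_ops a"
  shows "(\<forall>n. degree (P n) = n) \<and>
         (\<forall>m n. m \<noteq> n \<longrightarrow> \<L> (P m * P n) = 0) \<and>
         ((\<forall>n\<ge>1. of_nat n * (of_nat n + a - 1) \<noteq> 0) \<longrightarrow> (\<forall>n. \<L> (P n * P n) \<noteq> 0))"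
proof -
  let ?b = "\<lambda>n. if n = 0 then 1 else a + 2 * of_nat n"
  let ?l = "\<lambda>n. of_nat n * (of_nat n + a - 1)"
  interpret three_term_recurrence "[:1, 1:]" P ?b ?l
    unfolding P_def by (rule derangement_ops_three_term)
  \<comment> \<open>The recurrence is in \<open>x + 1\<close>, so the functional is tested on powers
    of \<open>x + 1\<close> instead of \<open>x\<close>.\<close>
  have moments: "\<L> ([:1, 1:] ^ n) = motzkin ?b ?l n 0" for n
    unfolding \<L>_def moment_functional_derangement_poly_shifted moved_rlm_sum_eq_motzkin ..
  have "degree (P n) = n" for n
    using lead_coeff_P[of n] le_degree[of "P n" n] by simp
  moreover have "\<L> (P m * P n) = 0" if "m \<noteq> n" for m n
    using that moment_functional_P_mult_less[OF moments[unfolded \<L>_def]]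
    unfolding \<L>_def by (metis linorder_neqE_nat mult.commute)
  moreover have "\<L> (P n * P n) \<noteq> 0" if "\<forall>n\<ge>1. ?l n \<noteq> 0" for n
    using that moment_functional_P_square[OF moments[unfolded \<L>_def]]
    unfolding \<L>_def by (auto simp: prod_zero_iff)
  ultimately show ?thesis by blast
qed

end
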